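(* Let $m_1,m_2,k$ be positive integers and $r$ an integer with $0\le r<k$. Then \[\begin{aligned}&(k-r)\sum_{n=1}^\infty\frac{H_n^{(m_1)}H_n^{(m_2)}-H_n^{(m_1+m_2)}}{(n+r)(n+k)}\\&=\sum_{j=1}^{k-r}\sum_{n=1}^\infty\left\{\frac{H_n^{(m_1)}}{n^{m_2}(n+r+j-1)}+\frac{H_n^{(m_2)}}{n^{m_1}(n+r+j-1)}-\frac{2}{n^{m_1+m_2}(n+r+j-1)}\right\},\end{aligned}\] \[\begin{aligned}&(k-r)\sum_{n=1}^\infty\frac{\bar H_n^{(m_1)}\bar H_n^{(m_2)}-H_n^{(m_1+m_2)}}{(n+r)(n+k)}\\&=\sum_{j=1}^{k-r}\sum_{n=1}^\infty\left\{\frac{\bar H_n^{(m_1)}(-1)^{n-1}}{n^{m_2}(n+r+j-1)}+\frac{\bar H_n^{(m_2)}(-1)^{n-1}}{n^{m_1}(n+r+j-1)}-\frac{2}{n^{m_1+m_2}(n+r+j-1)}\right\},\end{aligned}\] \[\begin{aligned}&(k-r)\sum_{n=1}^\infty\frac{H_n^{(m_1)}\bar H_n^{(m_2)}-\bar H_n^{(m_1+m_2)}}{(n+r)(n+k)}\\&=\sum_{j=1}^{k-r}\sum_{n=1}^\infty\left\{\frac{H_n^{(m_1)}(-1)^{n-1}}{n^{m_2}(n+r+j-1)}+\frac{\bar H_n^{(m_2)}}{n^{m_1}(n+r+j-1)}-\frac{2(-1)^{n-1}}{n^{m_1+m_2}(n+r+j-1)}\right\}.\end{aligned}\] Moreover,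 for all positive integers $p,m,j$, and for $f(n)=H_n^{(m)}$ as well as for $f(n)=\bar H_n^{(m)}$, \[\sum_{n=1}^\infty\frac{f(n)}{n^p(n+j)}=\sum_{i=1}^{p-1}\frac{(-1)^{i-1}}{j^i}\sum_{n=1}^\infty\frac{f(n)}{n^{p+1-i}}+\frac{(-1)^{p-1}}{j^{p-1}}\sum_{n=1}^\infty\frac{f(n)}{n(n+j)}.\]
   Context: For positive integers $n,p$: $H_n^{(p)}=\sum_{j=1}^n j^{-p}$ and $\bar H_n^{(p)}=\sum_{j=1}^n(-1)^{j-1}j^{-p}$. Empty sums are $0$. *)

theory Defs
  imports Complex_Main
begin

definition gen_harm :: "nat \<Rightarrow> nat \<Rightarrow> real" where
  "gen_harm p n = (\<Sum>j=1..n. 1 / real j ^ p)"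

definition alt_harm :: "nat \<Rightarrow> nat \<Rightarrow> real" where
  "alt_harm p n = (\<Sum>j=1..n. (-1) ^ (j - 1) / real j ^ p)"

(* Series over n = 1, 2, 3, ..., as limits of partial sums.  The value of suminf is
   meaningful only for summable sequences, hence the companion predicate. *)

abbreviation series1 :: "(nat \<Rightarrow> real) \<Rightarrow> real" where
  "series1 a \<equiv> (\<Sum>n. a (Suc n))"

abbreviation summable1 :: "(nat \<Rightarrow> real) \<Rightarrow> bool" where
  "summable1 a \<equiv> summable (\<lambda>n. a (Suc n))"

end

theory Submission
  imports Defs "HOL-Analysis.Analysis"
begin

text \<open>
  Write \<open>D n = S n * T n - U n\<close>, where \<open>S\<close>, \<open>T\<close>, \<open>U\<close> are the partial sums of \<open>a\<close>, \<open>b\<close>, \<open>a * b\<close>.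
  Then \<open>D n - D (n - 1) = a n * T n + b n * S n - 2 * a n * b n\<close>, and the first three identities are
  summation by parts of \<open>D n * (1 / (n + c) - 1 / (n + c + 1))\<close>, added up over \<open>c = r, \<dots>, k - 1\<close>.
  The boundary terms vanish and all series converge absolutely because the partial sums are
  \<open>O(ln n)\<close>.  The last identity iterates
  \<open>1 / (n ^ (p + 1) * (n + j)) = (1 / n ^ (p + 1) - 1 / (n ^ p * (n + j))) / j\<close>.
\<close>

section \<open>Growth of the partial sums\<close>

text \<open>Trades the logarithm for a small power. The exponent 1/4 leaves room twice: a product of
  two such sums is O(n powr (1/2)), hence o(n), and a single one divided by n^2 is still summable.
  The constant is 4 + 1, from ln n <= 4 * n powr (1/4) and 1 <= n powr (1/4).\<close>

lemma abs_partial_sum_le_powr: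
  fixes a :: "nat \<Rightarrow> real"
  assumes "\<And>j. j \<ge> 1 \<Longrightarrow> \<bar>a j\<bar> \<le> 1 / real j"
  shows "\<bar>\<Sum>j=1..n. a j\<bar> \<le> 5 * real n powr (1/4)"
proof (cases "n = 0")
  case False
  have "\<bar>\<Sum>j=1..n. a j\<bar> \<le> (\<Sum>j=1..n. 1 / real j)"
    by (rule order_trans[OF sum_abs]) (rule sum_mono, use assms in auto)
  also have "\<dots> = harm n"
    by (simp add: harm_def inverse_eq_divide)
  also have "\<dots> \<le> ln (real n) + 1"
    using False euler_mascheroni_sequence_decreasing[of 1 n] by (simp add: harm_def)
  also have "\<dots> \<le> real n powr (1/4) / (1/4) + real n powr (1/4)"
    using False by (intro add_mono ln_powr_bound ge_one_powr_ge_zero) auto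
  finally show ?thesis by simp
qed simp

lemma summable_Suc_powr_bound:
  fixes g :: "nat \<Rightarrow> real"
  assumes "e < -1" and "\<And>n. n \<ge> 1 \<Longrightarrow> \<bar>g n\<bar> \<le> C * real n powr e"
  shows "summable (\<lambda>n. g (Suc n))"
proof (rule summable_comparison_test')
  have "summable (\<lambda>n. C * real n powr e)"
    using assms(1) by (intro summable_mult) (simp add: summable_real_powr_iff)
  then show "summable (\<lambda>n. C * real (Suc n) powr e)"
    by (subst summable_Suc_iff)
  show "norm (g (Suc n)) \<le> C * real (Suc n) powr e" if "n \<ge> 0" for n
    using assms(2)[of "Suc n"] by simp
qed

section \<open>Summation by parts and the product identities\<close>

text \<open>Only the series of increments is assumed to converge. The partial sums on both sides
  differ by one boundary term, which is O(N powr (-1/2)), so convergence of the other series and its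
  value come together.\<close>

lemma sums_by_parts_reciprocal:
  fixes D :: "nat \<Rightarrow> real" and c :: nat
  assumes "D 0 = 0" and D: "\<And>n. \<bar>D n\<bar> \<le> C * real n powr (1/2)"
    and s: "summable (\<lambda>n. (D (Suc n) - D n) / (real (Suc n) + real c))"
  shows "(\<lambda>n. D (Suc n) * (1 / (real (Suc n) + real c) - 1 / (real (Suc n) + real c + 1)))
    sums (\<Sum>n. (D (Suc n) - D n) / (real (Suc n) + real c))"
proof -
  have partial: "(\<Sum>n<N. D (Suc n) * (1 / (real (Suc n) + real c) - 1 / (real (Suc n) + real c + 1)))
      = (\<Sum>n<N. (D (Suc n) - D n) / (real (Suc n) + real c)) - D N / (real N + real c + 1)" for N
    by (induction N) (simp_all add: assms(1) algebra_simps diff_divide_distrib)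
  have "(\<lambda>N. D N / (real N + real c + 1)) \<longlonglongrightarrow> 0"
  proof (rule Lim_null_comparison)
    show "\<forall>\<^sub>F N in sequentially. norm (D N / (real N + real c + 1)) \<le> C * real N powr (-1/2)"
    proof (rule eventually_sequentiallyI)
      fix N :: nat
      assume "1 \<le> N"
      have "norm (D N / (real N + real c + 1)) \<le> \<bar>D N\<bar> / real N"
        using \<open>1 \<le> N\<close> by (auto simp: abs_mult intro!: divide_left_mono)
      also have "\<dots> \<le> C * real N powr (1/2) / real N"
        using D[of N] by (intro divide_right_mono) auto
      also have "\<dots> = C * real N powr (-1/2)"
        using \<open>1 \<le> N\<close> powr_diff[of "real N" "1/2" 1] by simp
      finally show "norm (D N / (real N + real c + 1)) \<le> C * real N powr (-1/2)" .
    qed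
    have "(\<lambda>N. real N powr (-1/2)) \<longlonglongrightarrow> 0"
      by (rule tendsto_neg_powr) (auto intro: filterlim_real_sequentially)
    then show "(\<lambda>N. C * real N powr (-1/2)) \<longlonglongrightarrow> 0"
      by (rule tendsto_mult_right_zero)
  qed
  with summable_LIMSEQ[OF s] show ?thesis
    unfolding sums_def partial by (auto dest: tendsto_diff)
qed

text \<open>The exponents add up to 1/4 - 1 - 1 = -7/4 < -1. With c = 0 this also covers
  denominators that are pure powers.\<close>

lemma summable_harmonic_over_linear:
  fixes S b :: "nat \<Rightarrow> real" and c :: nat
  assumes S: "\<And>n. \<bar>S n\<bar> \<le> 5 * real n powr (1/4)" and b: "\<And>n. n \<ge> 1 \<Longrightarrow> \<bar>b n\<bar> \<le> 1 / real n"
  shows "summable (\<lambda>n. S (Suc n) * b (Suc n) / (real (Suc n) + real c))"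
proof (rule summable_Suc_powr_bound[where g = "\<lambda>n. S n * b n / (real n + real c)" and e = "-7/4" and C = 5])
  fix n :: nat
  assume n: "n \<ge> 1"
  have "\<bar>S n * b n\<bar> \<le> (5 * real n powr (1/4)) * (1 / real n)"
    unfolding abs_mult using S b[OF n] by (intro mult_mono) auto
  then have "\<bar>S n * b n / (real n + real c)\<bar> \<le> (5 * real n powr (1/4)) * (1 / real n) / real n"
    using n by (simp add: abs_divide del: times_divide_eq_right) (intro frac_le, auto)
  also have "\<dots> = 5 * real n powr (-7/4)"
    using n powr_diff[of "real n" "1/4" 2] by (simp add: power2_eq_square)
  finally show "\<bar>S n * b n / (real n + real c)\<bar> \<le> 5 * real n powr (-7/4)" .
qed simp

text \<open>Leaving \<open>a\<close> and \<open>b\<close> abstract handles all three sign patterns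
  at once: plain or alternating reciprocal powers satisfy the same bound, and only their termwise
  product distinguishes the cases.\<close>

lemma series_product_partial_sums:
  fixes a b :: "nat \<Rightarrow> real" and r k :: nat
  assumes a: "\<And>n. n \<ge> 1 \<Longrightarrow> \<bar>a n\<bar> \<le> 1 / real n" and b: "\<And>n. n \<ge> 1 \<Longrightarrow> \<bar>b n\<bar> \<le> 1 / real n"
    and "r < k"
  defines "S \<equiv> \<lambda>n. \<Sum>j=1..n. a j" and "T \<equiv> \<lambda>n. \<Sum>j=1..n. b j"
    and "U \<equiv> \<lambda>n. \<Sum>j=1..n. a j * b j"
  defines "d \<equiv> \<lambda>n. S n * b n + T n * a n - 2 * (a n * b n)"
  shows "summable1 (\<lambda>n. (S n * T n - U n) / ((real n + real r) * (real n + real k)))"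
    and "\<forall>j\<in>{1..k - r}. summable1 (\<lambda>n. d n / (real n + real r + real j - 1))"
    and "(real k - real r) * series1 (\<lambda>n. (S n * T n - U n) / ((real n + real r) * (real n + real k)))
      = (\<Sum>j=1..k - r. series1 (\<lambda>n. d n / (real n + real r + real j - 1)))"
proof -
  define D where "D = (\<lambda>n. S n * T n - U n)"
  have ab: "\<bar>a n * b n\<bar> \<le> 1 / real n" if n: "n \<ge> 1" for n
  proof -
    have "\<bar>a n * b n\<bar> \<le> (1 / real n) * 1"
      unfolding abs_mult using n a[OF n] order_trans[OF b[OF n], of 1] by (intro mult_mono) auto
    then show ?thesis by simp
  qed
  have S: "\<bar>S n\<bar> \<le> 5 * real n powr (1/4)" and T: "\<bar>T n\<bar> \<le> 5 * real n powr (1/4)"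
    and U: "\<bar>U n\<bar> \<le> 5 * real n powr (1/4)" for n
    unfolding S_def T_def U_def by (intro abs_partial_sum_le_powr a b ab; assumption)+
  \<comment> \<open>30 = 5 * 5 + 5: the product contributes 25, and \<open>U\<close> contributes 5
    after its exponent is raised from 1/4 to 1/2.\<close>
  have D_bound: "\<bar>D n\<bar> \<le> 30 * real n powr (1/2)" for n
  proof (cases "n = 0")
    case False
    have "\<bar>S n * T n\<bar> \<le> (5 * real n powr (1/4)) * (5 * real n powr (1/4))"
      unfolding abs_mult using S T by (intro mult_mono) auto
    also have "\<dots> = 25 * real n powr (1/2)"
      using powr_add[of "real n" "1/4" "1/4"] by simp
    finally have "\<bar>S n * T n\<bar> \<le> 25 * real n powr (1/2)" .
    moreover have "real n powr (1/4) \<le> real n powr (1/2)"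
      using False by (intro powr_mono) auto
    ultimately show ?thesis
      using U[of n] abs_triangle_ineq4[of "S n * T n" "U n"] unfolding D_def by linarith
  qed (simp add: D_def S_def U_def)
  have D_0: "D 0 = 0"
    by (simp add: D_def S_def U_def)
  \<comment> \<open>\<open>S\<close> and \<open>T\<close> at \<open>Suc n\<close> already contain
    the new terms, so the increment of \<open>S * T\<close> is S b + T a - a b; the increment of
    \<open>U\<close> removes a b a second time, whence the factor 2.\<close>
  have D_Suc: "D (Suc n) - D n = d (Suc n)" for n
    by (simp add: D_def d_def S_def T_def U_def algebra_simps)
  have d_sum: "summable (\<lambda>n. d (Suc n) / (real (Suc n) + real c))" for c :: nat
  proof -
    \<comment> \<open>The indicator of n > 0 plays the role of \<open>S\<close>, so that the
      diagonal term a b falls under the same summability lemma. The constant 1 would violate the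
      bound at n = 0, where the right-hand side vanishes.\<close>
    have one: "\<bar>of_bool (n > 0)\<bar> \<le> 5 * real n powr (1/4)" for n
      using ge_one_powr_ge_zero[of "real n" "1/4"] by (cases "n = 0") auto
    have "summable (\<lambda>n. S (Suc n) * b (Suc n) / (real (Suc n) + real c)
        + T (Suc n) * a (Suc n) / (real (Suc n) + real c)
        - 2 * (of_bool (Suc n > 0) * (a (Suc n) * b (Suc n)) / (real (Suc n) + real c)))"
      by (intro summable_diff summable_add summable_mult summable_harmonic_over_linear
            S T a b
          summable_harmonic_over_linear[where S = "\<lambda>n. of_bool (n > 0)" and b = "\<lambda>n. a n * b n"]
            one ab; assumption)
    then show ?thesis
      by (simp add: d_def add_divide_distrib diff_divide_distrib)
  qed
  \<comment> \<open>j >= 1 makes the natural subtraction exact, so the shift is a natural number c =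
    r + j - 1.\<close>
  have idx: "real n + real r + real j - 1 = real n + real (r + j - 1)" if "j \<in> {1..k - r}" for n j
    using that by (auto simp: of_nat_diff)
  show "\<forall>j\<in>{1..k - r}. summable1 (\<lambda>n. d n / (real n + real r + real j - 1))"
  proof
    fix j
    assume "j \<in> {1..k - r}"
    then show "summable1 (\<lambda>n. d n / (real n + real r + real j - 1))"
      using d_sum[of "r + j - 1"] by (simp only: idx)
  qed
  \<comment> \<open>The unit-gap differences telescope to 1 / (n + r) - 1 / (n + k), whose numerator
    over the common denominator is k - r.\<close>
  have split: "(\<Sum>j=1..k - r. D (Suc n) * (1 / (real (Suc n) + real (r + j - 1))
        - 1 / (real (Suc n) + real (r + j - 1) + 1)))
      = (real k - real r) * (D (Suc n) / ((real (Suc n) + real r) * (real (Suc n) + real k)))" for n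
  proof -
    have "(\<Sum>j=1..K. 1 / (real (Suc n) + real (r + j - 1)) - 1 / (real (Suc n) + real (r + j - 1) + 1))
      = 1 / (real (Suc n) + real r) - 1 / (real (Suc n) + real (r + K))" for K
      by (induction K) (simp_all add: algebra_simps)
    from this[of "k - r"] \<open>r < k\<close>
    show ?thesis
      unfolding sum_distrib_left[symmetric] by (simp add: field_simps)
  qed
  have "(\<lambda>n. \<Sum>j=1..k - r. D (Suc n) * (1 / (real (Suc n) + real (r + j - 1))
        - 1 / (real (Suc n) + real (r + j - 1) + 1)))
      sums (\<Sum>j=1..k - r. \<Sum>n. (D (Suc n) - D n) / (real (Suc n) + real (r + j - 1)))"
    using D_0 D_bound d_sum[folded D_Suc] by (intro sums_sum sums_by_parts_reciprocal)
  then have sums: "(\<lambda>n. (real k - real r) * (D (Suc n) / ((real (Suc n) + real r) * (real (Suc n) + real k))))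
      sums (\<Sum>j=1..k - r. series1 (\<lambda>n. d n / (real n + real r + real j - 1)))"
    unfolding split D_Suc by (simp only: idx cong: sum.cong)
  \<comment> \<open>The factor k - r is nonzero because r < k, so it can be cancelled from the
    summability statement.\<close>
  then show *: "summable1 (\<lambda>n. (S n * T n - U n) / ((real n + real r) * (real n + real k)))"
    using \<open>r < k\<close> sums_summable[OF sums] unfolding summable_cmult_iff D_def by simp
  show "(real k - real r) * series1 (\<lambda>n. (S n * T n - U n) / ((real n + real r) * (real n + real k)))
      = (\<Sum>j=1..k - r. series1 (\<lambda>n. d n / (real n + real r + real j - 1)))"
    using sums_unique[OF sums] suminf_mult[OF *, of "real k - real r"] unfolding D_def by simp
qed

section \<open>Termwise bounds and reduction of the power of n\<close>

lemma inverse_power_le_inverse: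
  assumes "m > 0" and "n \<ge> 1"
  shows "1 / real n ^ m \<le> 1 / real n"
proof -
  have "real n ^ 1 \<le> real n ^ m"
    using assms by (intro power_increasing) auto
  then show ?thesis
    using assms by (intro divide_left_mono) auto
qed

lemma abs_harmonic_terms_le:
  assumes "m > 0" and "n \<ge> 1"
  shows "\<bar>1 / real n ^ m\<bar> \<le> 1 / real n" and "\<bar>(-1) ^ (n - 1) / real n ^ m\<bar> \<le> 1 / real n"
  using inverse_power_le_inverse[OF assms] by (simp_all add: power_abs)

text \<open>Only the growth of \<open>f\<close> matters, so plain and alternating harmonic numbers
  need no separate treatment. The powers split off have exponents p + 1 - i >= 2, which is what
  makes their series converge.\<close>

lemma series_over_power_times_linear:
  fixes f :: "nat \<Rightarrow> real" and p j :: nat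
  assumes f: "\<And>n. \<bar>f n\<bar> \<le> 5 * real n powr (1/4)" and "p > 0" and "j > 0"
  shows "summable1 (\<lambda>n. f n / (real n ^ p * (real n + real j)))"
    and "\<forall>i\<in>{1..p - 1}. summable1 (\<lambda>n. f n / real n ^ (p + 1 - i))"
    and "series1 (\<lambda>n. f n / (real n ^ p * (real n + real j)))
        = (\<Sum>i=1..p - 1. (-1) ^ (i - 1) / real j ^ i * series1 (\<lambda>n. f n / real n ^ (p + 1 - i)))
          + (-1) ^ (p - 1) / real j ^ (p - 1) * series1 (\<lambda>n. f n / (real n * (real n + real j)))"
proof -
  have F: "summable1 (\<lambda>n. f n / (real n ^ q * (real n + real c)))" if "q > 0" for q c :: nat
    using summable_harmonic_over_linear[of f "\<lambda>n. 1 / real n ^ q" c] f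
      abs_harmonic_terms_le(1)[OF that] by simp
  then show "summable1 (\<lambda>n. f n / (real n ^ p * (real n + real j)))"
    using \<open>p > 0\<close> .
  have G: "summable1 (\<lambda>n. f n / real n ^ Suc q)" if "q > 0" for q
    using F[OF that, of 0] by (simp add: mult.commute)
  show "\<forall>i\<in>{1..p - 1}. summable1 (\<lambda>n. f n / real n ^ (p + 1 - i))"
  proof
    fix i
    assume "i \<in> {1..p - 1}"
    then have "p + 1 - i = Suc (p - i)" "p - i > 0" by auto
    then show "summable1 (\<lambda>n. f n / real n ^ (p + 1 - i))"
      using G[of "p - i"] by simp
  qed
  show "series1 (\<lambda>n. f n / (real n ^ p * (real n + real j)))
        = (\<Sum>i=1..p - 1. (-1) ^ (i - 1) / real j ^ i * series1 (\<lambda>n. f n / real n ^ (p + 1 - i)))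
          + (-1) ^ (p - 1) / real j ^ (p - 1) * series1 (\<lambda>n. f n / (real n * (real n + real j)))"
    using \<open>p > 0\<close>
  \<comment> \<open>For p = 1 the finite sum is empty and both sides are the same series.\<close>
  proof (induction p rule: nat_induct_non_zero)
    case (Suc q)
    let ?c = "\<lambda>i. (-1) ^ (i - 1) / real j ^ i :: real"
    let ?G = "\<lambda>e. series1 (\<lambda>n. f n / real n ^ e)"
    let ?F1 = "series1 (\<lambda>n. f n / (real n * (real n + real j)))"
    have "f (Suc n) / (real (Suc n) ^ Suc q * (real (Suc n) + real j))
        = (f (Suc n) / real (Suc n) ^ Suc q - f (Suc n) / (real (Suc n) ^ q * (real (Suc n) + real j))) / real j" for n
    proof -
      \<comment> \<open>Partial fractions from z = (y + z) - y, with y = n, w = n^q and z =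
        j.\<close>
      have "x / (y * w * (y + z)) = (x / (y * w) - x / (w * (y + z))) / z"
        if "y > 0" "w > 0" "z > 0" for x y z w :: real
        using that by (simp add: divide_simps add_pos_pos) (simp add: algebra_simps)
      from this[of "real (Suc n)" "real (Suc n) ^ q" "real j"] \<open>j > 0\<close> show ?thesis by simp
    qed
    then have "series1 (\<lambda>n. f n / (real n ^ Suc q * (real n + real j)))
        = (?G (Suc q) - series1 (\<lambda>n. f n / (real n ^ q * (real n + real j)))) / real j"
      using suminf_divide[OF summable_diff[OF G[OF Suc.hyps] F[OF Suc.hyps, of j]]]
        suminf_diff[OF G[OF Suc.hyps] F[OF Suc.hyps, of j]] by simp
    also have "\<dots> = ?G (Suc q) / real j - (\<Sum>i=1..q - 1. ?c i * ?G (q + 1 - i)) / real j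
        - (-1) ^ (q - 1) / real j ^ (q - 1) * ?F1 / real j"
      unfolding Suc.IH by (simp add: diff_divide_distrib add_divide_distrib)
    also have "(-1) ^ (q - 1) / real j ^ (q - 1) * ?F1 / real j = - ((-1) ^ q / real j ^ q * ?F1)"
      using Suc.hyps by (cases q) auto
    \<comment> \<open>Dividing \<open>?c i\<close> by j gives minus \<open>?c (Suc i)\<close>, and
      raising both q and i by one preserves the exponent q + 1 - i.\<close>
    also have "(\<Sum>i=1..q - 1. ?c i * ?G (q + 1 - i)) / real j
        = - (\<Sum>i=Suc 1..Suc (q - 1). ?c i * ?G (Suc q + 1 - i))"
      unfolding sum.shift_bounds_cl_Suc_ivl sum_divide_distrib sum_negf[symmetric]
    proof (rule sum.cong)
      fix i
      assume "i \<in> {1..q - 1}"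
      then show "?c i * ?G (q + 1 - i) / real j = - (?c (Suc i) * ?G (Suc q + 1 - Suc i))"
        by (cases i) auto
    qed simp
    \<comment> \<open>The isolated quotient is exactly the i = 1 term that the shifted range 2..q
      lacks.\<close>
    also have "?G (Suc q) / real j - - (\<Sum>i=Suc 1..Suc (q - 1). ?c i * ?G (Suc q + 1 - i))
        = (\<Sum>i=1..q. ?c i * ?G (Suc q + 1 - i))"
      using Suc.hyps by (subst (2) sum.atLeast_Suc_atMost) auto
    finally show ?case by simp
  qed simp
qed

section \<open>Specialisation to harmonic and alternating harmonic numbers\<close>

theorem corollary3p13:
  fixes m1 m2 k r :: nat
  assumes "m1 > 0" and "m2 > 0" and "k > 0" and "r < k"
  shows "
    (summable1 (\<lambda>n. (gen_harm m1 n * gen_harm m2 n - gen_harm (m1 + m2) n)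
            / ((real n + real r) * (real n + real k)))
      \<and> (\<forall>j\<in>{1..k - r}. summable1 (\<lambda>n. gen_harm m1 n / (real n ^ m2 * (real n + real r + real j - 1))
            + gen_harm m2 n / (real n ^ m1 * (real n + real r + real j - 1))
            - 2 / (real n ^ (m1 + m2) * (real n + real r + real j - 1))))
      \<and> (real k - real r) * series1 (\<lambda>n. (gen_harm m1 n * gen_harm m2 n - gen_harm (m1 + m2) n)
            / ((real n + real r) * (real n + real k)))
        = (\<Sum>j=1..k - r. series1 (\<lambda>n. gen_harm m1 n / (real n ^ m2 * (real n + real r + real j - 1))
            + gen_harm m2 n / (real n ^ m1 * (real n + real r + real j - 1))
            - 2 / (real n ^ (m1 + m2) * (real n + real r + real j - 1)))))
    \<and> (summable1 (\<lambda>n. (alt_harm m1 n * alt_harm m2 n - gen_harm (m1 + m2) n)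
            / ((real n + real r) * (real n + real k)))
      \<and> (\<forall>j\<in>{1..k - r}. summable1 (\<lambda>n. alt_harm m1 n * (-1) ^ (n - 1) / (real n ^ m2 * (real n + real r + real j - 1))
            + alt_harm m2 n * (-1) ^ (n - 1) / (real n ^ m1 * (real n + real r + real j - 1))
            - 2 / (real n ^ (m1 + m2) * (real n + real r + real j - 1))))
      \<and> (real k - real r) * series1 (\<lambda>n. (alt_harm m1 n * alt_harm m2 n - gen_harm (m1 + m2) n)
            / ((real n + real r) * (real n + real k)))
        = (\<Sum>j=1..k - r. series1 (\<lambda>n. alt_harm m1 n * (-1) ^ (n - 1) / (real n ^ m2 * (real n + real r + real j - 1))
            + alt_harm m2 n * (-1) ^ (n - 1) / (real n ^ m1 * (real n + real r + real j - 1))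
            - 2 / (real n ^ (m1 + m2) * (real n + real r + real j - 1)))))
    \<and> (summable1 (\<lambda>n. (gen_harm m1 n * alt_harm m2 n - alt_harm (m1 + m2) n)
            / ((real n + real r) * (real n + real k)))
      \<and> (\<forall>j\<in>{1..k - r}. summable1 (\<lambda>n. gen_harm m1 n * (-1) ^ (n - 1) / (real n ^ m2 * (real n + real r + real j - 1))
            + alt_harm m2 n / (real n ^ m1 * (real n + real r + real j - 1))
            - 2 * (-1) ^ (n - 1) / (real n ^ (m1 + m2) * (real n + real r + real j - 1))))
      \<and> (real k - real r) * series1 (\<lambda>n. (gen_harm m1 n * alt_harm m2 n - alt_harm (m1 + m2) n)
            / ((real n + real r) * (real n + real k)))
        = (\<Sum>j=1..k - r. series1 (\<lambda>n. gen_harm m1 n * (-1) ^ (n - 1) / (real n ^ m2 * (real n + real r + real j - 1))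
            + alt_harm m2 n / (real n ^ m1 * (real n + real r + real j - 1))
            - 2 * (-1) ^ (n - 1) / (real n ^ (m1 + m2) * (real n + real r + real j - 1)))))
    \<and> (\<forall>p m j :: nat. p > 0 \<longrightarrow> m > 0 \<longrightarrow> j > 0 \<longrightarrow>
      (\<forall>f\<in>{gen_harm m, alt_harm m}.
        summable1 (\<lambda>n. f n / (real n ^ p * (real n + real j)))
      \<and> (\<forall>i\<in>{1..p - 1}. summable1 (\<lambda>n. f n / real n ^ (p + 1 - i)))
      \<and> summable1 (\<lambda>n. f n / (real n * (real n + real j)))
      \<and> series1 (\<lambda>n. f n / (real n ^ p * (real n + real j)))
        = (\<Sum>i=1..p - 1. (-1) ^ (i - 1) / real j ^ i * series1 (\<lambda>n. f n / real n ^ (p + 1 - i)))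
          + (-1) ^ (p - 1) / real j ^ (p - 1) * series1 (\<lambda>n. f n / (real n * (real n + real j)))))"
proof -
  define h :: "nat \<Rightarrow> nat \<Rightarrow> real" where "h = (\<lambda>m n. 1 / real n ^ m)"
  define g :: "nat \<Rightarrow> nat \<Rightarrow> real" where "g = (\<lambda>m n. (-1) ^ (n - 1) / real n ^ m)"
  have h: "\<bar>h m n\<bar> \<le> 1 / real n" and g: "\<bar>g m n\<bar> \<le> 1 / real n" if "m > 0" "n \<ge> 1" for m n
    unfolding h_def g_def using abs_harmonic_terms_le[OF that] by blast+
  have H: "(\<lambda>n. \<Sum>j=1..n. h m j) = gen_harm m" and G: "(\<lambda>n. \<Sum>j=1..n. g m j) = alt_harm m" for m
    by (simp_all add: fun_eq_iff h_def g_def gen_harm_def alt_harm_def)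
  \<comment> \<open>Two alternating signs cancel, while a single one survives; this decides whether
    \<open>U\<close> becomes \<open>gen_harm\<close> or \<open>alt_harm\<close> of order m1 +
    m2.\<close>
  have hh: "h m1 n * h m2 n = h (m1 + m2) n" and gg: "g m1 n * g m2 n = h (m1 + m2) n"
    and hg: "h m1 n * g m2 n = g (m1 + m2) n" for n
    by (simp_all add: h_def g_def power_add flip: power_mult_distrib)
  have eqs: "(S * h m n + T * h m' n - 2 * h m'' n) / x
        = S / (real n ^ m * x) + T / (real n ^ m' * x) - 2 / (real n ^ m'' * x)"
      "(S * g m n + T * g m' n - 2 * h m'' n) / x
        = S * (-1) ^ (n - 1) / (real n ^ m * x) + T * (-1) ^ (n - 1) / (real n ^ m' * x)
          - 2 / (real n ^ m'' * x)"
      "(S * g m n + T * h m' n - 2 * g m'' n) / x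
        = S * (-1) ^ (n - 1) / (real n ^ m * x) + T / (real n ^ m' * x)
          - 2 * (-1) ^ (n - 1) / (real n ^ m'' * x)" for S T x m m' m'' n
    by (simp_all add: h_def g_def add_divide_distrib diff_divide_distrib)
  note s1 = series_product_partial_sums[of "h m1" "h m2", OF h h \<open>r < k\<close>,
      OF \<open>m1 > 0\<close> _ \<open>m2 > 0\<close>, unfolded hh fun_cong[OF H] eqs]
  note s2 = series_product_partial_sums[of "g m1" "g m2", OF g g \<open>r < k\<close>,
      OF \<open>m1 > 0\<close> _ \<open>m2 > 0\<close>, unfolded gg fun_cong[OF H] fun_cong[OF G] eqs]
  note s3 = series_product_partial_sums[of "h m1" "g m2", OF h g \<open>r < k\<close>,
      OF \<open>m1 > 0\<close> _ \<open>m2 > 0\<close>, unfolded hg fun_cong[OF H] fun_cong[OF G] eqs]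
  have "\<forall>f\<in>{gen_harm m, alt_harm m}.
        summable1 (\<lambda>n. f n / (real n ^ p * (real n + real j)))
      \<and> (\<forall>i\<in>{1..p - 1}. summable1 (\<lambda>n. f n / real n ^ (p + 1 - i)))
      \<and> summable1 (\<lambda>n. f n / (real n * (real n + real j)))
      \<and> series1 (\<lambda>n. f n / (real n ^ p * (real n + real j)))
        = (\<Sum>i=1..p - 1. (-1) ^ (i - 1) / real j ^ i * series1 (\<lambda>n. f n / real n ^ (p + 1 - i)))
          + (-1) ^ (p - 1) / real j ^ (p - 1) * series1 (\<lambda>n. f n / (real n * (real n + real j)))"
    if "p > 0" "m > 0" "j > 0" for p m j :: nat
  proof
    fix f
    assume "f \<in> {gen_harm m, alt_harm m}"
    then have "\<bar>f n\<bar> \<le> 5 * real n powr (1/4)" for n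
      using abs_partial_sum_le_powr[of "h m" n, OF h] abs_partial_sum_le_powr[of "g m" n, OF g] \<open>m > 0\<close>
      by (auto simp flip: H G)
    note * = series_over_power_times_linear[of f, OF this]
    show "summable1 (\<lambda>n. f n / (real n ^ p * (real n + real j)))
      \<and> (\<forall>i\<in>{1..p - 1}. summable1 (\<lambda>n. f n / real n ^ (p + 1 - i)))
      \<and> summable1 (\<lambda>n. f n / (real n * (real n + real j)))
      \<and> series1 (\<lambda>n. f n / (real n ^ p * (real n + real j)))
        = (\<Sum>i=1..p - 1. (-1) ^ (i - 1) / real j ^ i * series1 (\<lambda>n. f n / real n ^ (p + 1 - i)))
          + (-1) ^ (p - 1) / real j ^ (p - 1) * series1 (\<lambda>n. f n / (real n * (real n + real j)))"
      \<comment> \<open>The instance p = 1 supplies the summability of f n / (n * (n + j)).\<close>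
      using *[OF \<open>p > 0\<close> \<open>j > 0\<close>] *(1)[of 1, OF _ \<open>j > 0\<close>] by simp
  qed
  with s1 s2 s3 show ?thesis
    by (intro conjI allI impI)
qed

end
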